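(* Let $E$ be a directed graph that contains an uncountable emitter, i.e., a vertex $v$ such that $s^{-1}(v)$ is uncountable. Then $E$ does not admit any desingularization.
   Context: A directed graph $E=(E^0,E^1,r,s)$ consists of two disjoint sets $E^0$ (vertices), $E^1$ (edges) and maps $r,s:E^1\to E^0$ (range and source). A vertex $v$ is a sink if it emits no edges, and an infinite emitter if $s^{-1}(v)$ is infinite. If $v_0$ is a sink of $E$, adding a tail at $v_0$ means attaching to $E$ at $v_0$ a graph of the form $v_0\to v_1\to v_2\to v_3\to\cdots$ (with new vertices $v_1,v_2,\dots$ and one edge $v_{i-1}\to v_i$ for each $i\ge 1$). If $v_0$ is an infinite emitter of $E$, adding a tail at $v_0$ means the following: list the edges of $s^{-1}(v_0)$ as a sequence $e_1,e_2,e_3,\dots$; attach to $E$ at $v_0$ a tail $v_0\xrightarrow{f_1}v_1\xrightarrow{f_2}v_2\xrightarrow{f_3}v_3\to\cdots$ with new vertices $v_1,v_2,\dots$; remove the edges in $s^{-1}(v_0)$; and for every $e_j\in s^{-1}(v_0)$ draw an edge $g_j$ from $v_{j-1}$ to $r(e_j)$. A desingularization of $E$ is a graph $F$ formed by adding a tail to every sink and every infinite emitter of $E$ in this fashion. *)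

theory Defs
  imports "Graph_Theory.Graph_Theory" "HOL-Library.Countable_Set"
begin

text \<open>
  A directed graph $(E^0, E^1, r, s)$ is a \<^locale>\<open>wf_digraph\<close>, with
  $E^0$ = \<^const>\<open>verts\<close>, $E^1$ = \<^const>\<open>arcs\<close>, $r$ = \<^const>\<open>head\<close>,
  $s$ = \<^const>\<open>tail\<close> and $s^{-1}(v)$ = \<^const>\<open>out_arcs\<close>.  There is no size restriction; loops and
  parallel edges are allowed; vertices and edges are disjoint because they are typed separately.
  The source map \<^const>\<open>tail\<close> of the graph library is unrelated to the infinite
  path called a tail below.
\<close>

definition sink :: "('a, 'b) pre_digraph \<Rightarrow> 'a \<Rightarrow> bool" where
  "sink E v \<longleftrightarrow> v \<in> verts E \<and> out_arcs E v = {}"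

definition infinite_emitter :: "('a, 'b) pre_digraph \<Rightarrow> 'a \<Rightarrow> bool" where
  "infinite_emitter E v \<longleftrightarrow> v \<in> verts E \<and> infinite (out_arcs E v)"

definition uncountable_emitter :: "('a, 'b) pre_digraph \<Rightarrow> 'a \<Rightarrow> bool" where
  "uncountable_emitter E v \<longleftrightarrow> v \<in> verts E \<and> uncountable (out_arcs E v)"

text \<open>
  A vertex $v$ of $E$ becomes \<open>(v, 0)\<close>; the $n$-th vertex $v_n$ of the tail at $v$ is
  \<open>(v, n)\<close>, consistently with $v_0 = v$.  \<open>Old e\<close> is an edge of $E$ that is kept,
  \<open>Tail_arc v i\<close> (for $i \ge 1$) is the edge $f_i : v_{i-1} \to v_i$ of the tail at $v$, and
  \<open>Drawn_arc v j\<close> (for $j \ge 1$) is the edge $g_j : v_{j-1} \to r(e_j)$.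
\<close>

datatype ('a, 'b) tailed_arc = Old 'b | Tail_arc 'a nat | Drawn_arc 'a nat

text \<open>
  \<open>listing E v e\<close>: the sequence \<open>e 1, e 2, e 3, \<dots>\<close> lists the edges of $s^{-1}(v)$,
  each exactly once.
\<close>

definition listing :: "('a, 'b) pre_digraph \<Rightarrow> 'a \<Rightarrow> (nat \<Rightarrow> 'b) \<Rightarrow> bool" where
  "listing E v e \<longleftrightarrow> bij_betw e {1..} (out_arcs E v)"

text \<open>
  The result of adding, simultaneously, a tail at each vertex in \<open>S\<close>, a set of sinks and infinite
  emitters, where \<open>e v\<close> is the chosen listing of $s^{-1}(v)$ for each infinite emitter \<open>v\<close> in \<open>S\<close>.
  The values of \<open>e\<close> elsewhere do not matter.
\<close>

definition add_tails ::
  "'a set \<Rightarrow> ('a \<Rightarrow> nat \<Rightarrow> 'b) \<Rightarrow> ('a, 'b) pre_digraph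
    \<Rightarrow> ('a \<times> nat, ('a, 'b) tailed_arc) pre_digraph" where
  "add_tails S e E =
    \<lparr> verts = {(v, 0) | v. v \<in> verts E} \<union> {(v, n) | v n. v \<in> S \<and> n \<ge> 1},
      arcs = {Old a | a. a \<in> arcs E \<and> \<not> (tail E a \<in> S \<and> infinite_emitter E (tail E a))}
        \<union> {Tail_arc v i | v i. v \<in> S \<and> i \<ge> 1}
        \<union> {Drawn_arc v j | v j. v \<in> S \<and> infinite_emitter E v \<and> j \<ge> 1},
      tail = (\<lambda>x. case x of
          Old a \<Rightarrow> (tail E a, 0)
        | Tail_arc v i \<Rightarrow> (v, i - 1)
        | Drawn_arc v j \<Rightarrow> (v, j - 1)),
      head = (\<lambda>x. case x of
          Old a \<Rightarrow> (head E a, 0)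
        | Tail_arc v i \<Rightarrow> (v, i)
        | Drawn_arc v j \<Rightarrow> (head E (e v j), 0)) \<rparr>"

text \<open>
  A desingularization is determined only up to the names of the new vertices and edges, so \<open>F\<close> may
  be any graph, over any types, isomorphic to the one constructed by \<^const>\<open>add_tails\<close>.
\<close>

definition desingularization :: "('a, 'b) pre_digraph \<Rightarrow> ('c, 'd) pre_digraph \<Rightarrow> bool" where
  "desingularization E F \<longleftrightarrow>
    (\<exists>e. (\<forall>v. infinite_emitter E v \<longrightarrow> listing E v (e v)) \<and>
         digraph_iso (add_tails {v. sink E v \<or> infinite_emitter E v} e E) F)"

lemma wf_digraph_add_tails:
  assumes "wf_digraph E" "S \<subseteq> {v. sink E v \<or> infinite_emitter E v}"
    and "\<And>v. v \<in> S \<Longrightarrow> infinite_emitter E v \<Longrightarrow> listing E v (e v)"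
  shows "wf_digraph (add_tails S e E)"
proof -
  interpret wf_digraph E by fact
  have S: "v \<in> verts E" if "v \<in> S" for v
    using assms(2) that by (auto simp: sink_def infinite_emitter_def)
  have e: "e v j \<in> arcs E" if "v \<in> S" "infinite_emitter E v" "j \<ge> 1" for v j
    using assms(3)[OF that(1,2)] that(3) unfolding listing_def
    by (metis atLeast_iff bij_betwE in_out_arcs_conv)
  show ?thesis
    by unfold_locales (auto simp: add_tails_def S e)
qed

text \<open>
  The definition is not vacuous: without uncountable emitters, a desingularization exists.
\<close>

lemma desingularization_exists:
  fixes E :: "('a, 'b) pre_digraph"
  assumes "wf_digraph E" "\<nexists>v. uncountable_emitter E v"
  shows "\<exists>F :: ('a \<times> nat, ('a, 'b) tailed_arc) pre_digraph. desingularization E F"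
proof -
  have "\<exists>f. listing E v f" if v: "infinite_emitter E v" for v
  proof -
    from v assms(2) have "countable (out_arcs E v)" "infinite (out_arcs E v)"
      by (auto simp: infinite_emitter_def uncountable_emitter_def)
    then have "bij_betw (from_nat_into (out_arcs E v)) UNIV (out_arcs E v)"
      by (rule bij_betw_from_nat_into)
    moreover have "bij_betw (\<lambda>n. n - 1) {1::nat..} UNIV"
      by (rule bij_betwI[where g = Suc]) auto
    ultimately show ?thesis
      unfolding listing_def by (blast intro: bij_betw_trans)
  qed
  then obtain e where e: "\<And>v. infinite_emitter E v \<Longrightarrow> listing E v (e v)"
    by metis
  let ?F = "add_tails {v. sink E v \<or> infinite_emitter E v} e E"
  have wf: "wf_digraph ?F"
    by (rule wf_digraph_add_tails) (use assms(1) e in auto)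
  let ?h = "\<lparr>iso_verts = id, iso_arcs = id, iso_head = head ?F, iso_tail = tail ?F\<rparr>"
  have "pre_digraph.digraph_isomorphism ?F ?h"
    using wf by (simp add: pre_digraph.digraph_isomorphism_def)
  moreover have "?F = app_iso ?h ?F"
    by (simp add: app_iso_def)
  ultimately have "digraph_iso ?F ?F"
    unfolding digraph_iso_def by blast
  with e show ?thesis
    unfolding desingularization_def by blast
qed

end

theory Submission
  imports Defs
begin

text \<open>
  The obstruction to adding a tail lies in its first step: it asks for the edges leaving an infinite
  emitter to be written as a sequence \<open>e\<^sub>1, e\<^sub>2, \<dots>\<close>, so they are countably many.  An uncountable
  emitter is in particular an infinite emitter, and hence must be given a tail in any
  desingularization.
\<close>

lemma listing_imp_countable_out_arcs:
  assumes "listing E v e"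
  shows "countable (out_arcs E v)"
proof -
  have "out_arcs E v = e ` {1..}"
    using assms by (simp add: listing_def bij_betw_def)
  then show ?thesis
    by simp
qed

lemma uncountable_emitter_imp_infinite_emitter:
  "uncountable_emitter E v \<Longrightarrow> infinite_emitter E v"
  by (auto simp: uncountable_emitter_def infinite_emitter_def uncountable_infinite)

theorem theorem3p10:
  fixes E :: "('a, 'b) pre_digraph"
  assumes "wf_digraph E"
    and "\<exists>v. uncountable_emitter E v"
  shows "\<not> (\<exists>F :: ('c, 'd) pre_digraph. desingularization E F)"
proof
  assume "\<exists>F :: ('c, 'd) pre_digraph. desingularization E F"
  then obtain e where e: "\<And>v. infinite_emitter E v \<Longrightarrow> listing E v (e v)"
    unfolding desingularization_def by blast
  obtain v where v: "uncountable_emitter E v"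
    using assms(2) by blast
  have "countable (out_arcs E v)"
    by (rule listing_imp_countable_out_arcs[OF e[OF uncountable_emitter_imp_infinite_emitter[OF v]]])
  with v show False
    by (simp add: uncountable_emitter_def)
qed

end
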